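(* Let $C_{3}$ be the simplicial complex obtained from $3$ disjoint copies of $Q^*$ by identifying them along the subcomplex $A^*$. Then $C_3$ is balanced, Cohen-Macaulay (over any field), and not partitionable. (Its $f$-vector is $(1,22,101,140,60)$.)
   Context: $Q^*$ is the $3$-dimensional simplicial complex on vertex set $\{0,1,\dots,13\}$ whose faces are all subsets of the following $20$ facets: $\{2,5,6,12\}$, $\{1,5,8,11\}$, $\{0,1,2,5\}$, $\{1,4,8,9\}$, $\{1,2,3,10\}$, $\{4,5,8,13\}$, $\{0,1,2,3\}$, $\{1,4,9,10\}$, $\{1,2,9,10\}$, $\{1,2,5,6\}$, $\{0,2,5,12\}$, $\{4,5,7,13\}$, $\{1,4,5,8\}$, $\{1,2,6,9\}$, $\{1,3,4,7\}$, $\{1,3,4,10\}$, $\{1,5,6,11\}$, $\{1,4,5,7\}$, $\{1,6,9,11\}$, $\{1,8,9,11\}$. $A^*$ is the induced subcomplex of $Q^*$ on vertex set $\{0,2,3,4,6,7,8,10,12,13\}$; its facets are $\{0,2,3\}$, $\{4,7,13\}$, $\{3,4,10\}$, $\{0,2,12\}$, $\{3,4,7\}$, $\{2,3,10\}$, $\{2,6,12\}$, $\{4,8,13\}$. Identifying $N$ copies of $Q^*$ along $A^*$ means taking copies $Q^*_1,\dots,Q^*_N$ with pairwise disjoint vertex sets except that the vertices of $A^*$ are shared (the same in all copies). A $(d-1)$-dimensional complex is balanced if its graph is properly $d$-colorable. A pure simplicial complex with facets $F_1,\dots,F_n$ is partitionable if its faces are the disjoint union of Boolean intervals $[R_i,F_i]=\{G: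 R_i\subseteq G\subseteq F_i\}$. A $(d-1)$-dimensional complex $\Delta$ is Cohen-Macaulay over a field $\mathbb{F}$ if for every face $F$ (including $\emptyset$), $\widetilde{H}_i(\mathrm{lk}_\Delta(F);\mathbb{F})=0$ for all $i\neq d-1-\#F$, where $\mathrm{lk}_\Delta(F)=\{G\in\Delta: G\cap F=\emptyset, G\cup F\in\Delta\}$. The $f$-vector lists the numbers of faces of dimensions $-1,0,1,2,3$. *)

theory Defs
  imports Main "HOL-Library.Product_Lexorder"
begin

definition link :: "'a set set \<Rightarrow> 'a set \<Rightarrow> 'a set set" where
  "link \<Delta> F = {G \<in> \<Delta>. G \<inter> F = {} \<and> G \<union> F \<in> \<Delta>}"

text \<open>The number d for a (d-1)-dimensional complex: the maximal face size.\<close>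
definition cx_d :: "'a set set \<Rightarrow> nat" where
  "cx_d \<Delta> = Max (card ` \<Delta>)"

definition facets :: "'a set set \<Rightarrow> 'a set set" where
  "facets \<Delta> = {F \<in> \<Delta>. \<forall>G \<in> \<Delta>. F \<subseteq> G \<longrightarrow> G = F}"

text \<open>An i-chain (i :: int, i >= -1) with coefficients in a field: a function on
  faces supported on the faces of cardinality i+1 (the empty face is the unique
  (-1)-face). Orientation of faces is induced by the linear order on vertices.\<close>
definition is_chain :: "'a set set \<Rightarrow> int \<Rightarrow> ('a set \<Rightarrow> 'k::field) \<Rightarrow> bool" where
  "is_chain \<Delta> i c \<longleftrightarrow> (\<forall>G. c G \<noteq> 0 \<longrightarrow> G \<in> \<Delta> \<and> finite G \<and> int (card G) = i + 1)"

definition bd :: "('a::linorder) set set \<Rightarrow> ('a set \<Rightarrow> 'k::field) \<Rightarrow> 'a set \<Rightarrow> 'k" where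
  "bd \<Delta> c G = (\<Sum>v \<in> \<Union>\<Delta> - G. (- 1) ^ card {u \<in> G. u < v} * c (insert v G))"

definition homology_vanishes :: "'k::field itself \<Rightarrow> ('a::linorder) set set \<Rightarrow> int \<Rightarrow> bool" where
  "homology_vanishes K \<Delta> i \<longleftrightarrow>
     (\<forall>c :: 'a set \<Rightarrow> 'k. is_chain \<Delta> i c \<and> bd \<Delta> c = (\<lambda>_. 0) \<longrightarrow>
        (\<exists>b :: 'a set \<Rightarrow> 'k. is_chain \<Delta> (i + 1) b \<and> bd \<Delta> b = c))"

definition cohen_macaulay :: "'k::field itself \<Rightarrow> ('a::linorder) set set \<Rightarrow> bool" where
  "cohen_macaulay K \<Delta> \<longleftrightarrow>
     (\<forall>F \<in> \<Delta>. \<forall>i::int. i \<noteq> int (cx_d \<Delta>) - 1 - int (card F) \<longrightarrow>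
        homology_vanishes K (link \<Delta> F) i)"

definition balanced :: "'a set set \<Rightarrow> bool" where
  "balanced \<Delta> \<longleftrightarrow> (\<exists>\<kappa> :: 'a \<Rightarrow> nat. (\<forall>v. \<kappa> v < cx_d \<Delta>) \<and>
      (\<forall>u v. {u, v} \<in> \<Delta> \<and> u \<noteq> v \<longrightarrow> \<kappa> u \<noteq> \<kappa> v))"

definition partitionable :: "'a set set \<Rightarrow> bool" where
  "partitionable \<Delta> \<longleftrightarrow> (\<exists>R :: 'a set \<Rightarrow> 'a set.
      (\<forall>F \<in> facets \<Delta>. R F \<subseteq> F) \<and>
      (\<forall>G \<in> \<Delta>. \<exists>!F. F \<in> facets \<Delta> \<and> R F \<subseteq> G \<and> G \<subseteq> F))"

definition Qstar_facets :: "nat set set" where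
  "Qstar_facets = {{2,5,6,12}, {1,5,8,11}, {0,1,2,5}, {1,4,8,9}, {1,2,3,10}, {4,5,8,13},
     {0,1,2,3}, {1,4,9,10}, {1,2,9,10}, {1,2,5,6}, {0,2,5,12}, {4,5,7,13}, {1,4,5,8},
     {1,2,6,9}, {1,3,4,7}, {1,3,4,10}, {1,5,6,11}, {1,4,5,7}, {1,6,9,11}, {1,8,9,11}}"

definition Qstar :: "nat set set" where
  "Qstar = {G. \<exists>F \<in> Qstar_facets. G \<subseteq> F}"

definition Astar :: "nat set set" where
  "Astar = {G \<in> Qstar. G \<subseteq> {0,2,3,4,6,7,8,10,12,13}}"

text \<open>N copies of Q indexed by k < N; vertex v of copy k becomes (k+1, v), except
  that vertices of A are shared and become (0, v).\<close>
definition copy_vertex :: "'a set set \<Rightarrow> nat \<Rightarrow> 'a \<Rightarrow> nat \<times> 'a" where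
  "copy_vertex A k v = (if v \<in> \<Union>A then (0, v) else (Suc k, v))"

definition identify_copies :: "nat \<Rightarrow> 'a set set \<Rightarrow> 'a set set \<Rightarrow> (nat \<times> 'a) set set" where
  "identify_copies N Q A = {copy_vertex A k ` G | k G. k < N \<and> G \<in> Q}"

definition C3 :: "(nat \<times> nat) set set" where
  "C3 = identify_copies 3 Qstar Astar"

end

theory Submission
  imports Defs
begin

text \<open>Cohen-Macaulayness: \<open>Qstar\<close> and \<open>Astar\<close> are shellable and any two copies of \<open>Qstar\<close> meet in
  \<open>Astar\<close>, so \<open>C3\<close> is constructible. Mayer-Vietoris, applied to all links, propagates vanishing
  homology along a constructible decomposition.

  Non-partitionability: a face of a copy of \<open>Qstar\<close> outside \<open>Astar\<close> lies only in facets of that copy,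
  so a partition of \<open>C3\<close> restricts, in each copy, to intervals that cover each such face exactly once.
  This forces one of the two shared edges \<open>{2, 6}\<close> and \<open>{4, 8}\<close> to be covered by a facet of that copy.
  With three copies, one of the edges is covered twice.\<close>

section \<open>Simplicial chains\<close>

text \<open>A vertex outside \<open>\<Union>\<Delta>\<close> contributes only values of
  \<open>c\<close> on non-faces, which are zero. Chains of several subcomplexes can therefore share
  the boundary operator of an ambient complex.\<close>

lemma bd_cong_Union:
  assumes "is_chain \<Delta> i c" "\<Union>\<Delta> \<subseteq> \<Union>\<Delta>'" "finite (\<Union>\<Delta>')"
  shows "bd \<Delta>' c = bd \<Delta> c"
proof
  fix G
  show "bd \<Delta>' c G = bd \<Delta> c G"
    unfolding bd_def
  proof (rule sum.mono_neutral_right)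
    show "\<forall>v\<in>\<Union>\<Delta>' - G - (\<Union>\<Delta> - G). (- 1) ^ card {u \<in> G. u < v} * c (insert v G) = 0"
    proof
      fix v assume v: "v \<in> \<Union>\<Delta>' - G - (\<Union>\<Delta> - G)"
      then have "insert v G \<notin> \<Delta>" by blast
      then have "c (insert v G) = 0" using assms(1) by (auto simp: is_chain_def)
      then show "(- 1) ^ card {u \<in> G. u < v} * c (insert v G) = 0" by simp
    qed
  qed (use assms in auto)
qed

lemma bd_diff: "bd \<Delta> (\<lambda>G. b G - c G) = (\<lambda>G. bd \<Delta> b G - bd \<Delta> c G)"
  by (simp add: bd_def fun_eq_iff right_diff_distrib sum_subtractf)

lemma bd_add: "bd \<Delta> (\<lambda>G. b G + c G) = (\<lambda>G. bd \<Delta> b G + bd \<Delta> c G)"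
  by (simp add: bd_def fun_eq_iff distrib_left sum.distrib)

lemma bd_zero: "bd \<Delta> (\<lambda>_. 0) = (\<lambda>_. 0)"
  by (simp add: bd_def fun_eq_iff)

lemma bd_nonzeroD:
  assumes "bd \<Delta> c G \<noteq> 0"
  obtains v where "v \<notin> G" "c (insert v G) \<noteq> 0"
proof -
  have "\<exists>v\<in>\<Union>\<Delta> - G. (- 1) ^ card {u \<in> G. u < v} * c (insert v G) \<noteq> 0"
    using assms unfolding bd_def by (meson sum.not_neutral_contains_not_neutral)
  then show thesis using that by auto
qed

text \<open>The vertex range \<open>\<Delta>'\<close> is independent of \<open>\<Delta>\<close>, so
  a boundary taken in an ambient complex is still a chain of the subcomplex.\<close>

lemma is_chain_bd:
  assumes c: "is_chain \<Delta> i c" and down: "\<forall>F\<in>\<Delta>. Pow F \<subseteq> \<Delta>"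
  shows "is_chain \<Delta> (i - 1) (bd \<Delta>' c)"
  unfolding is_chain_def
proof (intro allI impI)
  fix G assume "bd \<Delta>' c G \<noteq> 0"
  then obtain v where v: "v \<notin> G" "c (insert v G) \<noteq> 0" by (rule bd_nonzeroD)
  then have "insert v G \<in> \<Delta>" "finite (insert v G)" "int (card (insert v G)) = i + 1"
    using c by (auto simp: is_chain_def)
  then show "G \<in> \<Delta> \<and> finite G \<and> int (card G) = i - 1 + 1"
    using v down by auto
qed

text \<open>Inserting the smaller vertex \<open>v\<close> shifts the position of \<open>w\<close> by
  one, while inserting \<open>w\<close> leaves the position of \<open>v\<close> unchanged.\<close>

lemma incidence_sign_swap:
  fixes v w :: "'a::linorder"
  assumes "finite G" "v \<notin> G" "w \<notin> G" "v < w"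
  shows "(- 1) ^ card {u \<in> G. u < v} * (- 1) ^ card {u \<in> insert v G. u < w}
    = - ((- 1) ^ card {u \<in> G. u < w} * (- 1) ^ card {u \<in> insert w G. u < v} :: 'k::field)"
proof -
  have "{u \<in> insert v G. u < w} = insert v {u \<in> G. u < w}" using assms by auto
  then have "card {u \<in> insert v G. u < w} = Suc (card {u \<in> G. u < w})" using assms by simp
  moreover have "{u \<in> insert w G. u < v} = {u \<in> G. u < v}" using assms by auto
  ultimately show ?thesis by simp
qed

lemma bd_bd:
  fixes c :: "('a::linorder) set \<Rightarrow> 'k::field"
  assumes c: "is_chain \<Delta> i c" and fin: "finite (\<Union>\<Delta>')"
  shows "bd \<Delta>' (bd \<Delta>' c) = (\<lambda>_. 0)"
proof
  fix G :: "'a set"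
  let ?V = "\<Union>\<Delta>' - G"
  let ?s = "\<lambda>G v. (- 1) ^ card {u \<in> G. u < v} :: 'k"
  let ?t = "\<lambda>v w. ?s G v * (?s (insert v G) w * c (insert w (insert v G)))"
  show "bd \<Delta>' (bd \<Delta>' c) G = 0"
  proof (cases "finite G")
    \<comment> \<open>The sign rule needs a finite \<open>G\<close>; on infinite sets chains vanish
      anyway.\<close>
    case False
    then have "c (insert w (insert v G)) = 0" for v w
      using c by (auto simp: is_chain_def)
    then show ?thesis by (simp add: bd_def)
  next
    case True
    have V: "finite ?V" using fin by simp
    have "bd \<Delta>' (bd \<Delta>' c) G = (\<Sum>v\<in>?V. \<Sum>w\<in>\<Union>\<Delta>' - insert v G. ?t v w)"
      by (simp add: bd_def sum_distrib_left)
    also have "\<dots> = (\<Sum>v\<in>?V. (\<Sum>w\<in>{w\<in>?V. v < w}. ?t v w) + (\<Sum>w\<in>{w\<in>?V. w < v}. ?t v w))"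
    proof (rule sum.cong[OF refl])
      fix v assume "v \<in> ?V"
      have "\<Union>\<Delta>' - insert v G = {w\<in>?V. v < w} \<union> {w\<in>?V. w < v}" by auto
      moreover have "finite {w\<in>?V. v < w}" "finite {w\<in>?V. w < v}"
        using V by (rule rev_finite_subset, blast)+
      moreover have "{w\<in>?V. v < w} \<inter> {w\<in>?V. w < v} = {}" by auto
      ultimately show "(\<Sum>w\<in>\<Union>\<Delta>' - insert v G. ?t v w)
        = (\<Sum>w\<in>{w\<in>?V. v < w}. ?t v w) + (\<Sum>w\<in>{w\<in>?V. w < v}. ?t v w)"
        by (simp only: sum.union_disjoint)
    qed
    also have "\<dots> = (\<Sum>v\<in>?V. \<Sum>w\<in>{w\<in>?V. v < w}. ?t v w) + (\<Sum>v\<in>?V. \<Sum>w\<in>{w\<in>?V. w < v}. ?t v w)"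
      by (rule sum.distrib)
    \<comment> \<open>Exchanging the two sums turns the pairs with \<open>w < v\<close> into those
      with \<open>v < w\<close>, where the sign rule makes them cancel the other half.\<close>
    also have "(\<Sum>v\<in>?V. \<Sum>w\<in>{w\<in>?V. w < v}. ?t v w) = (\<Sum>w\<in>?V. \<Sum>v\<in>{v\<in>?V. w < v}. ?t v w)"
      by (rule sum.swap_restrict[OF V V])
    also have "\<dots> = (\<Sum>v\<in>?V. \<Sum>w\<in>{w\<in>?V. v < w}. - ?t v w)"
    proof (intro sum.cong refl)
      fix v w assume "v \<in> ?V" "w \<in> {w\<in>?V. v < w}"
      then have "?s G v * ?s (insert v G) w = - (?s G w * ?s (insert w G) v)"
        using incidence_sign_swap[OF True, of v w] by blast
      then show "?t w v = - ?t v w"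
        by (simp add: insert_commute mult.assoc[symmetric])
    qed
    finally show ?thesis by (simp add: sum_negf)
  qed
qed

section \<open>Vanishing homology of unions and of simplices\<close>

text \<open>The Mayer-Vietoris zigzag on chains: split a cycle as \<open>c1 + c2\<close>, fill the
  boundary of \<open>c1\<close> by a chain \<open>e\<close> of the intersection, and fill the cycles
  \<open>c1 - e\<close> and \<open>c2 + e\<close> separately.\<close>

lemma mayer_vietoris_vanishes:
  fixes \<Delta>1 \<Delta>2 :: "('a::linorder) set set"
  assumes fin: "finite (\<Union>(\<Delta>1 \<union> \<Delta>2))"
    and down1: "\<forall>F\<in>\<Delta>1. Pow F \<subseteq> \<Delta>1"
    and down2: "\<forall>F\<in>\<Delta>2. Pow F \<subseteq> \<Delta>2"
    and v1: "homology_vanishes K \<Delta>1 i" and v2: "homology_vanishes K \<Delta>2 i"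
    and v12: "homology_vanishes (K :: 'k::field itself) (\<Delta>1 \<inter> \<Delta>2) (i - 1)"
  shows "homology_vanishes K (\<Delta>1 \<union> \<Delta>2) i"
  unfolding homology_vanishes_def
proof (intro allI impI)
  fix c :: "'a set \<Rightarrow> 'k"
  let ?U = "\<Delta>1 \<union> \<Delta>2"
  assume "is_chain ?U i c \<and> bd ?U c = (\<lambda>_. 0)"
  then have c: "is_chain ?U i c" and cyc: "bd ?U c = (\<lambda>_. 0)" by auto
  have bdU: "bd \<Delta> b = bd ?U b" if "is_chain \<Delta> j b" "\<Delta> \<subseteq> ?U" for \<Delta> j and b :: "'a set \<Rightarrow> 'k"
    using bd_cong_Union[OF that(1) Union_mono[OF that(2)] fin] by simp
  define c1 where "c1 = (\<lambda>G. if G \<in> \<Delta>1 then c G else 0)"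
  define c2 where "c2 = (\<lambda>G. c G - c1 G)"
  have ch1: "is_chain \<Delta>1 i c1" and ch2: "is_chain \<Delta>2 i c2"
    using c by (auto simp: is_chain_def c1_def c2_def)
  have bd2: "bd ?U c2 = (\<lambda>G. - bd ?U c1 G)"
    unfolding c2_def bd_diff cyc by simp
  then have "bd ?U c2 G \<noteq> 0" if "bd ?U c1 G \<noteq> 0" for G using that by simp
  \<comment> \<open>Up to sign this is also the boundary of \<open>c2\<close>, so it is supported on
    both subcomplexes.\<close>
  then have "is_chain (\<Delta>1 \<inter> \<Delta>2) (i - 1) (bd ?U c1)"
    using is_chain_bd[OF ch1 down1, where \<Delta>' = ?U] is_chain_bd[OF ch2 down2, where \<Delta>' = ?U]
    unfolding is_chain_def by blast
  moreover from this have "bd (\<Delta>1 \<inter> \<Delta>2) (bd ?U c1) = (\<lambda>_. 0)"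
    using bdU bd_bd[OF ch1 fin] by (metis inf.coboundedI1 sup_ge1)
  ultimately obtain e where e: "is_chain (\<Delta>1 \<inter> \<Delta>2) i e" "bd (\<Delta>1 \<inter> \<Delta>2) e = bd ?U c1"
    using v12 unfolding homology_vanishes_def by (metis diff_add_cancel)
  have eU: "bd ?U e = bd ?U c1" using e bdU[OF e(1)] by (metis inf.coboundedI1 sup_ge1)
  have d1: "is_chain \<Delta>1 i (\<lambda>G. c1 G - e G)" and d2: "is_chain \<Delta>2 i (\<lambda>G. c2 G + e G)"
    using ch1 ch2 e(1) unfolding is_chain_def by (metis IntD1 diff_zero diff_self, metis IntD2 add_0)
  have "bd ?U (\<lambda>G. c1 G - e G) = (\<lambda>_. 0)" "bd ?U (\<lambda>G. c2 G + e G) = (\<lambda>_. 0)"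
    unfolding bd_diff bd_add eU bd2 by auto
  then have "bd \<Delta>1 (\<lambda>G. c1 G - e G) = (\<lambda>_. 0)" "bd \<Delta>2 (\<lambda>G. c2 G + e G) = (\<lambda>_. 0)"
    using bdU[OF d1] bdU[OF d2] by auto
  then obtain b1 b2 where b:
      "is_chain \<Delta>1 (i + 1) b1" "bd \<Delta>1 b1 = (\<lambda>G. c1 G - e G)"
      "is_chain \<Delta>2 (i + 1) b2" "bd \<Delta>2 b2 = (\<lambda>G. c2 G + e G)"
    using v1 v2 d1 d2 unfolding homology_vanishes_def by blast
  have "bd ?U (\<lambda>G. b1 G + b2 G) = c"
    unfolding bd_add using b bdU[OF b(1)] bdU[OF b(3)] by (simp add: c2_def fun_eq_iff)
  moreover have "is_chain ?U (i + 1) (\<lambda>G. b1 G + b2 G)"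
    using b(1,3) unfolding is_chain_def by (metis UnCI add_0)
  ultimately show "\<exists>b. is_chain ?U (i + 1) b \<and> bd ?U b = c" by blast
qed

text \<open>The contracting homotopy is the cone over the least vertex, for which all signs are trivial.\<close>
lemma homology_vanishes_Pow:
  fixes S :: "('a::linorder) set"
  assumes fin: "finite S" and ne: "S \<noteq> {}"
  shows "homology_vanishes (K :: 'k::field itself) (Pow S) i"
  unfolding homology_vanishes_def
proof (intro allI impI)
  fix c :: "'a set \<Rightarrow> 'k"
  assume "is_chain (Pow S) i c \<and> bd (Pow S) c = (\<lambda>_. 0)"
  then have c: "is_chain (Pow S) i c" and cyc: "bd (Pow S) c = (\<lambda>_. 0)" by auto
  define v where "v = Min S"
  have v: "v \<in> S" and vmin: "\<And>w. w \<in> S \<Longrightarrow> w \<noteq> v \<Longrightarrow> v < w"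
    using fin ne by (auto simp: v_def order.not_eq_order_implies_strict)
  define b where "b = (\<lambda>G. if v \<in> G then c (G - {v}) else 0)"
  let ?s = "\<lambda>G w. (- 1) ^ card {u \<in> G. u < w} :: 'k"
  have supp: "G \<subseteq> S" "finite G" "int (card G) = i + 1" if "c G \<noteq> 0" for G
    using c that by (auto simp: is_chain_def)
  have sv: "?s H v = 1" if "H \<subseteq> S" for H
  proof -
    have "{u \<in> H. u < v} = {}" using that vmin by fastforce
    then show ?thesis by (simp only: card.empty power_0)
  qed
  have "is_chain (Pow S) (i + 1) b"
    unfolding is_chain_def
  proof (intro allI impI)
    fix G assume "b G \<noteq> 0"
    then have G: "v \<in> G" "c (G - {v}) \<noteq> 0" by (auto simp: b_def split: if_splits)
    from supp[OF G(2)] v G(1) have "G \<subseteq> S" "finite G" by auto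
    moreover have "card G = Suc (card (G - {v}))" using \<open>finite G\<close> G(1) by (rule card.remove)
    ultimately show "G \<in> Pow S \<and> finite G \<and> int (card G) = i + 1 + 1"
      using supp(3)[OF G(2)] by simp
  qed
  moreover have "bd (Pow S) b H = c H" for H
  proof (cases "H \<subseteq> S")
    case False
    have "bd (Pow S) b H = 0"
    proof (rule ccontr)
      assume "bd (Pow S) b H \<noteq> 0"
      then obtain w where "b (insert w H) \<noteq> 0" by (rule bd_nonzeroD)
      then have "insert w H - {v} \<subseteq> S" using supp by (auto simp: b_def split: if_splits)
      with v False show False by blast
    qed
    then show ?thesis using False supp by metis
  next
    case H: True
    then have finH: "finite H" using fin finite_subset by blast
    show ?thesis
    proof (cases "v \<in> H")
      case False
      have "bd (Pow S) b H = (\<Sum>w\<in>S - H. if w = v then c H else 0)"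
        unfolding bd_def Union_Pow_eq
      proof (rule sum.cong[OF refl])
        fix w assume "w \<in> S - H"
        show "?s H w * b (insert w H) = (if w = v then c H else 0)"
          using False sv[OF H] by (auto simp: b_def)
      qed
      then show ?thesis using False v fin by simp
    next
      case True
      have rest: "?s H w * b (insert w H) = - (?s (H - {v}) w * c (insert w (H - {v})))"
        if "w \<in> S - H" for w
      proof -
        have "v < w" using that True vmin by blast
        then have "{u \<in> H. u < w} = insert v {u \<in> H - {v}. u < w}" using True by auto
        then have "card {u \<in> H. u < w} = Suc (card {u \<in> H - {v}. u < w})" using finH by simp
        moreover have "insert w H - {v} = insert w (H - {v})" using \<open>v < w\<close> by auto
        ultimately show ?thesis using True by (simp add: b_def)
      qed
      \<comment> \<open>The cycle condition at \<open>H - {v}\<close> consists of the term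
        \<open>c H\<close>, with sign 1, and a sum that equals the negative of
        \<open>bd (Pow S) b H\<close> by \<open>rest\<close>.\<close>
      have "S - (H - {v}) = insert v (S - H)" using v True by auto
      moreover have "insert v (H - {v}) = H" using True by auto
      ultimately have "bd (Pow S) c (H - {v})
          = c H + (\<Sum>w\<in>S - H. ?s (H - {v}) w * c (insert w (H - {v})))"
        using sv[of "H - {v}"] H True fin by (simp add: bd_def subset_iff)
      then have "c H = - (\<Sum>w\<in>S - H. ?s (H - {v}) w * c (insert w (H - {v})))"
        unfolding cyc by (intro eq_neg_iff_add_eq_0[THEN iffD2]) (rule sym)
      also have "\<dots> = bd (Pow S) b H"
        using rest by (simp add: bd_def sum_negf)
      finally show ?thesis ..
    qed
  qed
  ultimately show "\<exists>b. is_chain (Pow S) (i + 1) b \<and> bd (Pow S) b = c" by blast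
qed

lemma homology_vanishes_no_faces:
  assumes "\<And>G. G \<in> \<Delta> \<Longrightarrow> finite G \<Longrightarrow> int (card G) \<noteq> i + 1"
  shows "homology_vanishes K \<Delta> i"
  unfolding homology_vanishes_def
proof (intro allI impI)
  fix c assume "is_chain \<Delta> i c \<and> bd \<Delta> c = (\<lambda>_. 0)"
  then have "c = (\<lambda>_. 0)" using assms by (auto simp: is_chain_def)
  then show "\<exists>b. is_chain \<Delta> (i + 1) b \<and> bd \<Delta> b = c"
    by (intro exI[of _ "\<lambda>_. 0"]) (simp add: is_chain_def bd_zero)
qed

section \<open>Constructible and shellable complexes\<close>

text \<open>The index \<open>d\<close> is the common cardinality of the facets.\<close>
inductive constructible :: "nat \<Rightarrow> 'a set set \<Rightarrow> bool" where
  simplex: "finite F \<Longrightarrow> card F = d \<Longrightarrow> constructible d (Pow F)"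
| union: "constructible (Suc d) \<Delta>1 \<Longrightarrow> constructible (Suc d) \<Delta>2 \<Longrightarrow> constructible d (\<Delta>1 \<inter> \<Delta>2)
    \<Longrightarrow> constructible (Suc d) (\<Delta>1 \<union> \<Delta>2)"

lemma constructible_finite_Union: "constructible d \<Delta> \<Longrightarrow> finite (\<Union>\<Delta>)"
  by (induction rule: constructible.induct) auto

lemma constructible_down: "constructible d \<Delta> \<Longrightarrow> \<forall>F\<in>\<Delta>. Pow F \<subseteq> \<Delta>"
  by (induction rule: constructible.induct) auto

section \<open>Links in constructible complexes\<close>

text \<open>Without the separate condition \<open>G \<in> \<Delta>\<close>, links visibly commute
  with unions of complexes.\<close>

lemma link_eq:
  assumes "\<forall>F\<in>\<Delta>. Pow F \<subseteq> \<Delta>"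
  shows "link \<Delta> F = {G. G \<inter> F = {} \<and> G \<union> F \<in> \<Delta>}"
proof -
  have "G \<in> \<Delta>" if "G \<union> F \<in> \<Delta>" for G
    using assms[rule_format, OF that] by auto
  then show ?thesis by (auto simp: link_def)
qed

lemma link_empty:
  assumes "\<forall>F\<in>\<Delta>. Pow F \<subseteq> \<Delta>" "F \<notin> \<Delta>"
  shows "link \<Delta> F = {}"
proof -
  have "G \<union> F \<notin> \<Delta>" for G
    using assms(1)[rule_format, of "G \<union> F"] assms(2) by auto
  then show ?thesis by (simp add: link_def)
qed

lemma link_subset: "link \<Delta> F \<subseteq> \<Delta>"
  by (auto simp: link_def)

lemma link_down:
  assumes "\<forall>F\<in>\<Delta>. Pow F \<subseteq> \<Delta>"
  shows "\<forall>G\<in>link \<Delta> F. Pow G \<subseteq> link \<Delta> F"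
proof (intro ballI subsetI)
  fix G H assume G: "G \<in> link \<Delta> F" and "H \<in> Pow G"
  then have "H \<union> F \<subseteq> G \<union> F" by blast
  then show "H \<in> link \<Delta> F" using assms G \<open>H \<in> Pow G\<close> unfolding link_def by blast
qed

text \<open>Links commute with the unions and intersections of the construction, so Mayer-Vietoris
  applies. Passing to the intersection lowers both \<open>d\<close> and \<open>i\<close> by one,
  which preserves the bound on \<open>i\<close>.\<close>

lemma constructible_link_vanishes:
  fixes \<Delta> :: "('a::linorder) set set"
  assumes "constructible d \<Delta>" "F \<in> \<Delta>" "i < int d - 1 - int (card F)"
  shows "homology_vanishes (K :: 'k::field itself) (link \<Delta> F) i"
  using assms
proof (induction arbitrary: i rule: constructible.induct)
  case (simplex T d)
  show ?case
  proof (cases "F = T")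
    case True
    \<comment> \<open>The link is \<open>{{}}\<close>, with homology only in degree -1, and here
      \<open>i < -1\<close>.\<close>
    then show ?thesis using simplex by (intro homology_vanishes_no_faces) auto
  next
    case False
    have "link (Pow T) F = Pow (T - F)" using simplex by (auto simp: link_def)
    then show ?thesis using False simplex by (auto intro!: homology_vanishes_Pow)
  qed
next
  case (union d \<Delta>1 \<Delta>2)
  note down = constructible_down[OF union.hyps(1)] constructible_down[OF union.hyps(2)]
  have "\<forall>F\<in>\<Delta>1 \<union> \<Delta>2. Pow F \<subseteq> \<Delta>1 \<union> \<Delta>2" using down by auto
  then have eq: "link (\<Delta>1 \<union> \<Delta>2) F = link \<Delta>1 F \<union> link \<Delta>2 F"
    using down by (auto simp: link_eq)
  show ?case
  proof (cases "F \<in> \<Delta>1 \<and> F \<in> \<Delta>2")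
    case False
    then have "F \<in> \<Delta>1 \<and> link \<Delta>2 F = {} \<or> F \<in> \<Delta>2 \<and> link \<Delta>1 F = {}"
      using union.prems(1) link_empty down by blast
    then show ?thesis using union.IH(1,2)[of i] union.prems(2) eq by auto
  next
    case True
    have "homology_vanishes K (link \<Delta>1 F \<union> link \<Delta>2 F) i"
    proof (rule mayer_vietoris_vanishes)
      have "\<Union>(link \<Delta>1 F \<union> link \<Delta>2 F) \<subseteq> \<Union>\<Delta>1 \<union> \<Union>\<Delta>2" using link_subset by blast
      then show "finite (\<Union>(link \<Delta>1 F \<union> link \<Delta>2 F))"
        using union.hyps constructible_finite_Union by (metis finite_Un finite_subset)
      have "link \<Delta>1 F \<inter> link \<Delta>2 F = link (\<Delta>1 \<inter> \<Delta>2) F" by (auto simp: link_def)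
      then show "homology_vanishes K (link \<Delta>1 F \<inter> link \<Delta>2 F) (i - 1)"
        using union.IH(3)[of "i - 1"] True union.prems by simp
    next
      show "homology_vanishes K (link \<Delta>1 F) i" "homology_vanishes K (link \<Delta>2 F) i"
        using True union.IH(1,2)[of i] union.prems(2) by auto
    qed (rule link_down down)+
    then show ?thesis by (simp add: eq)
  qed
qed

lemma constructible_card_le: "constructible d \<Delta> \<Longrightarrow> F \<in> \<Delta> \<Longrightarrow> card F \<le> d"
  by (induction rule: constructible.induct) (auto intro: card_mono)

lemma constructible_cx_d:
  assumes "constructible d \<Delta>"
  shows "cx_d \<Delta> = d"
proof -
  have "\<exists>F\<in>\<Delta>. card F = d"
    using assms by (induction rule: constructible.induct) auto
  moreover have "finite \<Delta>"
    using constructible_finite_Union[OF assms] by (rule finite_UnionD)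
  ultimately show ?thesis
    unfolding cx_d_def using constructible_card_le[OF assms] by (intro Max_eqI) auto
qed

text \<open>Below the top degree the previous induction applies; above it the link has no faces,
  since \<open>card G + card F \<le> d\<close>.\<close>

theorem constructible_cohen_macaulay:
  fixes \<Delta> :: "('a::linorder) set set"
  assumes "constructible d \<Delta>"
  shows "cohen_macaulay (K :: 'k::field itself) \<Delta>"
  unfolding cohen_macaulay_def constructible_cx_d[OF assms]
proof (intro ballI allI impI)
  fix F i assume F: "F \<in> \<Delta>" and i: "i \<noteq> int d - 1 - int (card F)"
  show "homology_vanishes K (link \<Delta> F) i"
  proof (cases "i < int d - 1 - int (card F)")
    case True
    with assms F show ?thesis by (rule constructible_link_vanishes)
  next
    case False
    have "int (card G) \<noteq> i + 1" if G: "G \<in> link \<Delta> F" for G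
    proof -
      have "finite F" "finite G"
        using constructible_finite_Union[OF assms] F G by (auto simp: link_def intro: finite_subset)
      moreover have "card (G \<union> F) \<le> d" "G \<inter> F = {}"
        using constructible_card_le[OF assms] G by (auto simp: link_def)
      ultimately show ?thesis using False i by (simp add: card_Un_disjoint)
    qed
    then show ?thesis by (intro homology_vanishes_no_faces)
  qed
qed

section \<open>From shellings to constructible complexes\<close>

text \<open>Ridges are added one at a time: the simplex on \<open>F - {w}\<close> meets the earlier
  ridges in ridges of its own, so induction applies one dimension lower.\<close>

lemma constructible_Union_ridges:
  assumes "finite F" "card F = Suc d" "R \<subseteq> F" "R \<noteq> {}"
  shows "constructible d (\<Union>v\<in>R. Pow (F - {v}))"
proof -
  have "finite R" using assms finite_subset by blast
  then show ?thesis using assms(4,1-3)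
  proof (induction R arbitrary: F d rule: finite_ne_induct)
    case (singleton v)
    then show ?case by (auto intro!: constructible.simplex)
  next
    case (insert w R)
    have eq: "(\<Union>v\<in>insert w R. Pow (F - {v})) = (\<Union>v\<in>R. Pow (F - {v})) \<union> Pow (F - {w})" by auto
    have int: "(\<Union>v\<in>R. Pow (F - {v})) \<inter> Pow (F - {w}) = (\<Union>v\<in>R. Pow (F - {w} - {v}))" by auto
    have sub: "R \<subseteq> F - {w}" using insert by auto
    moreover have card: "card (F - {w}) = d" using insert by auto
    \<comment> \<open>The nonempty set \<open>R\<close> lies in \<open>F - {w}\<close>, hence
      \<open>d > 0\<close>.\<close>
    ultimately obtain d' where d: "d = Suc d'"
      using insert by (metis card.empty card_gt_0_iff finite_Diff gr0_conv_Suc subset_empty)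
    have "constructible d' (\<Union>v\<in>R. Pow (F - {w} - {v}))"
      using insert.IH[of "F - {w}" d'] sub card d insert.prems by simp
    then show ?case
      unfolding eq d using insert card d
      by (intro constructible.union) (auto simp: int intro!: constructible.simplex)
  qed
qed

text \<open>A shelling order of facets, given as vertex lists and read from right to left.\<close>
fun shelling :: "'a list list \<Rightarrow> bool" where
  "shelling [] \<longleftrightarrow> True"
| "shelling (F # Fs) \<longleftrightarrow> shelling Fs \<and>
     (\<forall>G\<in>set Fs. \<exists>v\<in>set F. v \<notin> set G \<and> (\<exists>H\<in>set Fs. \<forall>u\<in>set F. u = v \<or> u \<in> set H))"

text \<open>The shelling condition says that each new facet meets the earlier complex in a nonempty
  union of its ridges, which is constructible.\<close>

lemma shelling_constructible:
  assumes "shelling Fs" "Fs \<noteq> []" "\<forall>F\<in>set Fs. card (set F) = Suc d"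
  shows "constructible (Suc d) (\<Union>F\<in>set Fs. Pow (set F))"
  using assms
proof (induction Fs)
  case (Cons F Fs)
  show ?case
  proof (cases "Fs = []")
    case True
    then show ?thesis using Cons by (auto intro!: constructible.simplex)
  next
    case False
    let ?\<Delta> = "\<Union>F\<in>set Fs. Pow (set F)"
    \<comment> \<open>These are the vertices whose opposite ridge in \<open>F\<close> already lies
      in an earlier facet.\<close>
    define R where "R = {v \<in> set F. \<exists>H\<in>set Fs. set F - {v} \<subseteq> set H}"
    have R: "\<exists>v\<in>R. v \<notin> set G" if "G \<in> set Fs" for G
      using Cons.prems(1) that unfolding R_def by fastforce
    have "?\<Delta> \<inter> Pow (set F) = (\<Union>v\<in>R. Pow (set F - {v}))"
    proof (intro equalityI subsetI)
      fix X assume "X \<in> ?\<Delta> \<inter> Pow (set F)"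
      then obtain G where "G \<in> set Fs" "X \<subseteq> set G" "X \<subseteq> set F" by auto
      with R[of G] show "X \<in> (\<Union>v\<in>R. Pow (set F - {v}))" by blast
    qed (auto simp: R_def)
    moreover have "R \<noteq> {}" using R[of "hd Fs"] False by auto
    then have "constructible d (\<Union>v\<in>R. Pow (set F - {v}))"
      using Cons.prems(3) by (intro constructible_Union_ridges) (auto simp: R_def)
    ultimately have "constructible (Suc d) (?\<Delta> \<union> Pow (set F))"
      using Cons False by (intro constructible.union) (auto intro!: constructible.simplex)
    then show ?thesis by (simp add: Un_commute)
  qed
qed simp

lemma constructible_image:
  assumes "constructible d \<Delta>" "inj f"
  shows "constructible d ((`) f ` \<Delta>)"
  using assms
proof (induction rule: constructible.induct)
  case (simplex F d)
  then show ?case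
    by (auto simp: image_Pow_surj card_image inj_on_subset intro!: constructible.simplex)
next
  case (union d \<Delta>1 \<Delta>2)
  have "(`) f ` (\<Delta>1 \<inter> \<Delta>2) = (`) f ` \<Delta>1 \<inter> (`) f ` \<Delta>2"
    using union.prems by (intro image_Int inj_on_image) (auto intro: inj_on_subset)
  then show ?case using union by (auto simp: image_Un intro!: constructible.union)
qed

section \<open>Gluing copies along an induced subcomplex\<close>

lemma inj_copy_vertex: "inj (copy_vertex A k)"
  by (auto simp: inj_def copy_vertex_def split: if_splits)

lemma copy_vertex_image_shared: "G \<subseteq> \<Union>A \<Longrightarrow> copy_vertex A k ` G = Pair 0 ` G"
  by (intro image_cong refl) (auto simp: copy_vertex_def)

text \<open>A vertex outside \<open>\<Union>A\<close> carries the index of its copy, so a face with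
  such a vertex determines the copy it lives in.\<close>

lemma copy_vertex_image_subset_iff:
  assumes "\<not> G \<subseteq> \<Union>A"
  shows "copy_vertex A k ` G \<subseteq> copy_vertex A l ` H \<longleftrightarrow> k = l \<and> G \<subseteq> H"
proof
  assume sub: "copy_vertex A k ` G \<subseteq> copy_vertex A l ` H"
  obtain v where v: "v \<in> G" "v \<notin> \<Union>A" using assms by blast
  then have "copy_vertex A k v = (Suc k, v)" by (simp add: copy_vertex_def)
  then have "(Suc k, v) \<in> copy_vertex A l ` H" using sub v by (metis imageI subsetD)
  then have "k = l" by (auto simp: copy_vertex_def split: if_splits)
  then show "k = l \<and> G \<subseteq> H" using sub by (simp add: inj_image_subset_iff[OF inj_copy_vertex])
qed auto

lemma identify_copies_eq: "identify_copies N Q A = (\<Union>k<N. (`) (copy_vertex A k) ` Q)"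
  by (auto simp: identify_copies_def)

text \<open>That \<open>A\<close> is induced is essential: a common face has all its vertices shared
  and so must lie in \<open>A\<close>. The index 0 on the right is arbitrary, as shared faces have
  the same image in every copy.\<close>

lemma copies_Int:
  assumes A: "A = {G \<in> Q. G \<subseteq> \<Union>A}" and "k \<noteq> l"
  shows "(`) (copy_vertex A k) ` Q \<inter> (`) (copy_vertex A l) ` Q = (`) (copy_vertex A 0) ` A"
proof (intro equalityI subsetI)
  fix X assume "X \<in> (`) (copy_vertex A k) ` Q \<inter> (`) (copy_vertex A l) ` Q"
  then obtain G H where X: "X = copy_vertex A k ` G" "G \<in> Q" "X = copy_vertex A l ` H" "H \<in> Q"
    by (elim IntE imageE)
  then have "G \<subseteq> \<Union>A"
    using copy_vertex_image_subset_iff[of G A k l H] \<open>k \<noteq> l\<close> by auto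
  then have "G \<in> A" "X = copy_vertex A 0 ` G"
    using X A by (auto simp: copy_vertex_image_shared)
  then show "X \<in> (`) (copy_vertex A 0) ` A" by blast
next
  fix X assume "X \<in> (`) (copy_vertex A 0) ` A"
  then obtain G where "G \<in> A" "X = copy_vertex A 0 ` G" by blast
  moreover from this have "G \<in> Q" "G \<subseteq> \<Union>A" using A by auto
  moreover have "X = copy_vertex A k ` G" "X = copy_vertex A l ` G"
    using \<open>X = _\<close> \<open>G \<subseteq> \<Union>A\<close> by (simp_all add: copy_vertex_image_shared)
  ultimately show "X \<in> (`) (copy_vertex A k) ` Q \<inter> (`) (copy_vertex A l) ` Q" by blast
qed

text \<open>Each further copy meets the union of the earlier ones in the shared \<open>A\<close>,
  which is constructible of one dimension less.\<close>

lemma constructible_identify_copies: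
  assumes Q: "constructible (Suc d) Q" and cA: "constructible d A" and A: "A = {G \<in> Q. G \<subseteq> \<Union>A}"
  shows "constructible (Suc d) (identify_copies (Suc N) Q A)"
proof (induction N)
  case 0
  then show ?case
    using constructible_image[OF Q inj_copy_vertex] by (simp add: identify_copies_eq lessThan_Suc)
next
  case (Suc N)
  let ?Q = "\<lambda>k. (`) (copy_vertex A k) ` Q"
  have "identify_copies (Suc N) Q A \<inter> ?Q (Suc N) = (\<Union>k<Suc N. ?Q k \<inter> ?Q (Suc N))"
    by (auto simp: identify_copies_eq)
  also have "\<dots> = (\<Union>k<Suc N. (`) (copy_vertex A 0) ` A)"
    using copies_Int[OF A] by (intro SUP_cong refl) auto
  also have "\<dots> = (`) (copy_vertex A 0) ` A" by auto
  finally have "constructible d (identify_copies (Suc N) Q A \<inter> ?Q (Suc N))"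
    using constructible_image[OF cA inj_copy_vertex] by simp
  then have "constructible (Suc d) (identify_copies (Suc N) Q A \<union> ?Q (Suc N))"
    using Suc constructible_image[OF Q inj_copy_vertex] by (intro constructible.union)
  moreover have "identify_copies (Suc (Suc N)) Q A = identify_copies (Suc N) Q A \<union> ?Q (Suc N)"
    by (auto simp: identify_copies_eq lessThan_Suc)
  ultimately show ?case by simp
qed

section \<open>Explicit shellings of \<open>Qstar\<close> and \<open>Astar\<close>\<close>

text \<open>Lists make the shelling condition executable; each one is strictly increasing so that
  faces can later be counted as lists.\<close>

definition Qstar_shelling :: "nat list list" where
  "Qstar_shelling = [[4, 5, 7, 13], [1, 4, 5, 7], [4, 5, 8, 13], [1, 4, 5, 8], [1, 5, 8, 11],
    [1, 8, 9, 11], [1, 6, 9, 11], [1, 5, 6, 11], [1, 3, 4, 7], [1, 3, 4, 10], [1, 2, 6, 9],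
    [0, 2, 5, 12], [1, 4, 8, 9], [1, 4, 9, 10], [1, 2, 9, 10], [1, 2, 3, 10], [0, 1, 2, 3],
    [0, 1, 2, 5], [1, 2, 5, 6], [2, 5, 6, 12]]"

definition Astar_shelling :: "nat list list" where
  "Astar_shelling = [[4, 8, 13], [4, 7, 13], [3, 4, 7], [3, 4, 10], [2, 3, 10], [2, 6, 12],
    [0, 2, 3], [0, 2, 12]]"

lemma Qstar_facets_shelling: "Qstar_facets = set ` set Qstar_shelling"
  unfolding Qstar_facets_def Qstar_shelling_def list.set image_insert image_empty
  apply (rule equalityI)
  subgoal by (intro insert_subset[THEN iffD2] conjI empty_subsetI) (rule insertI1 | rule insertI2)+
  subgoal by (intro insert_subset[THEN iffD2] conjI empty_subsetI) (rule insertI1 | rule insertI2)+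
  done

lemma Qstar_eq: "Qstar = (\<Union>F\<in>set Qstar_shelling. Pow (set F))"
  by (auto simp: Qstar_def Qstar_facets_shelling)

lemma shelling_Qstar: "shelling Qstar_shelling"
  unfolding Qstar_shelling_def by code_simp

lemma shelling_Astar: "shelling Astar_shelling"
  unfolding Astar_shelling_def by code_simp

section \<open>Counting faces\<close>

lemma sorted_wrt_subseqs: "l \<in> set (subseqs xs) \<Longrightarrow> sorted_wrt P xs \<Longrightarrow> sorted_wrt P l"
proof (induction xs arbitrary: l)
  case (Cons x xs)
  then consider "l \<in> set (subseqs xs)" | l' where "l = x # l'" "l' \<in> set (subseqs xs)"
    by (auto simp: Let_def)
  then show ?case
  proof cases
    case 2
    then have "set l' \<subseteq> set xs" using subseqs_powset[of xs] by blast
    then show ?thesis using 2 Cons by auto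
  qed (use Cons in simp)
qed simp

text \<open>A strictly increasing list is determined by its set, so distinct subsequences of the
  facets are distinct faces and the count can be evaluated.\<close>

lemma card_faces_eq_length:
  fixes Fs :: "'a::linorder list list"
  assumes "\<forall>F\<in>set Fs. sorted_wrt (<) F"
  shows "card {G \<in> (\<Union>F\<in>set Fs. Pow (set F)). P G}
    = length (remdups (filter (\<lambda>l. P (set l)) (concat (map subseqs Fs))))"
proof -
  let ?L = "remdups (filter (\<lambda>l. P (set l)) (concat (map subseqs Fs)))"
  have "sorted_wrt (<) l" if "l \<in> set ?L" for l
  proof -
    have "\<exists>F\<in>set Fs. l \<in> set (subseqs F)" using that by simp
    then obtain F where "F \<in> set Fs" "l \<in> set (subseqs F)" by blast
    then show ?thesis using assms sorted_wrt_subseqs by blast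
  qed
  then have "inj_on set (set ?L)"
    by (intro inj_onI) (simp add: strict_sorted_equal)
  moreover have "{G \<in> (\<Union>F\<in>set Fs. Pow (set F)). P G} = set ` set ?L"
    unfolding subseqs_powset[symmetric] by auto
  ultimately show ?thesis
    by (simp only: card_image length_remdups_card_conv set_remdups)
qed

text \<open>Faces on shared vertices are counted once, all others once per copy.\<close>

lemma card_identify_copies:
  assumes A: "A = {G \<in> Q. G \<subseteq> \<Union>A}" and fin: "finite Q" and "N > 0"
  shows "card {X \<in> identify_copies N Q A. card X = j}
    = card {G \<in> Q. G \<subseteq> \<Union>A \<and> card G = j} + N * card {G \<in> Q. \<not> G \<subseteq> \<Union>A \<and> card G = j}"
proof -
  let ?S = "{G \<in> Q. G \<subseteq> \<Union>A \<and> card G = j}" and ?T = "{G \<in> Q. \<not> G \<subseteq> \<Union>A \<and> card G = j}"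
  \<comment> \<open>Copy 0 represents every shared face, which is where \<open>N > 0\<close>
    enters.\<close>
  let ?D = "{0} \<times> ?S \<union> {..<N} \<times> ?T" and ?f = "\<lambda>(k, G). copy_vertex A k ` G"
  have card_copy: "card (copy_vertex A k ` G) = card G" for k G
    by (simp add: card_image inj_on_subset[OF inj_copy_vertex])
  have "{X \<in> identify_copies N Q A. card X = j} = ?f ` ?D"
  proof (intro equalityI subsetI)
    fix X assume "X \<in> {X \<in> identify_copies N Q A. card X = j}"
    then obtain k G where X: "X = copy_vertex A k ` G" "k < N" "G \<in> Q" "card G = j"
      by (auto simp: identify_copies_def card_copy)
    show "X \<in> ?f ` ?D"
    proof (cases "G \<subseteq> \<Union>A")
      case True
      then have "X = ?f (0, G)" using X by (simp add: copy_vertex_image_shared)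
      then show ?thesis using X True by blast
    next
      case False
      then have "X = ?f (k, G)" using X by simp
      then show ?thesis using X False by blast
    qed
  next
    fix X assume "X \<in> ?f ` ?D"
    then obtain k G where "X = copy_vertex A k ` G" "k < N" "G \<in> Q" "card G = j"
      using \<open>N > 0\<close> by auto
    then show "X \<in> {X \<in> identify_copies N Q A. card X = j}"
      by (auto simp: identify_copies_def card_copy)
  qed
  moreover have "inj_on ?f ?D"
  proof (rule inj_onI)
    fix x y assume xy: "x \<in> ?D" "y \<in> ?D" "?f x = ?f y"
    obtain k G l H where [simp]: "x = (k, G)" "y = (l, H)" by fastforce
    have eq: "copy_vertex A k ` G = copy_vertex A l ` H" using xy by simp
    have "k = l"
    proof (cases "G \<subseteq> \<Union>A \<and> H \<subseteq> \<Union>A")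
      case True
      then show ?thesis using xy by auto
    next
      case False
      then show ?thesis
        using copy_vertex_image_subset_iff[of G A k l H] copy_vertex_image_subset_iff[of H A l k G] eq
        by blast
    qed
    then show "x = y" using eq by (simp add: inj_image_eq_iff[OF inj_copy_vertex])
  qed
  moreover have "card ?D = card ?S + N * card ?T"
  proof -
    have "card ?D = card ({0::nat} \<times> ?S) + card ({..<N} \<times> ?T)"
      using fin by (intro card_Un_disjoint) auto
    then show ?thesis by (simp add: card_cartesian_product)
  qed
  ultimately show ?thesis by (simp add: card_image)
qed

section \<open>Constructibility and face numbers of the complexes\<close>

abbreviation Astar_vertices :: "nat set" where
  "Astar_vertices \<equiv> {0, 2, 3, 4, 6, 7, 8, 10, 12, 13}"

lemma Union_Astar: "\<Union>Astar = Astar_vertices"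
proof
  show "\<Union>Astar \<subseteq> Astar_vertices" unfolding Astar_def by blast
  have "\<forall>v\<in>Astar_vertices. \<exists>F\<in>set Qstar_shelling. v \<in> set F"
    unfolding Qstar_shelling_def by code_simp
  moreover have "v \<in> \<Union>Astar" if "v \<in> Astar_vertices" "F \<in> set Qstar_shelling" "v \<in> set F" for v F
  proof (rule UnionI)
    show "{v} \<in> Astar" using that unfolding Astar_def Qstar_eq by (simp only: mem_Collect_eq) blast
  qed simp
  ultimately show "Astar_vertices \<subseteq> \<Union>Astar" by blast
qed

lemma Astar_induced: "Astar = {G \<in> Qstar. G \<subseteq> \<Union>Astar}"
  by (simp only: Union_Astar) (simp only: Astar_def)

text \<open>The induced subcomplex is generated by the listed triangles: every facet of
  \<open>Qstar\<close> meets \<open>Astar_vertices\<close> inside one of them, and each of them is a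
  face of \<open>Qstar\<close> on these vertices.\<close>

lemma Astar_eq: "Astar = (\<Union>F\<in>set Astar_shelling. Pow (set F))"
proof (intro equalityI subsetI)
  fix G assume "G \<in> Astar"
  then obtain F where F: "F \<in> set Qstar_shelling" "G \<subseteq> set F" "G \<subseteq> Astar_vertices"
    unfolding Astar_def Qstar_eq by blast
  have "\<forall>F\<in>set Qstar_shelling. \<exists>H\<in>set Astar_shelling. \<forall>v\<in>set F. v \<in> Astar_vertices \<longrightarrow> v \<in> set H"
    unfolding Qstar_shelling_def Astar_shelling_def by code_simp
  then obtain H where "H \<in> set Astar_shelling" "\<forall>v\<in>set F. v \<in> Astar_vertices \<longrightarrow> v \<in> set H"
    using F(1) by blast
  then show "G \<in> (\<Union>F\<in>set Astar_shelling. Pow (set F))" using F by blast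
next
  fix G assume "G \<in> (\<Union>F\<in>set Astar_shelling. Pow (set F))"
  then obtain H where H: "H \<in> set Astar_shelling" "G \<subseteq> set H" by blast
  have "\<forall>H\<in>set Astar_shelling. set H \<subseteq> Astar_vertices \<and> (\<exists>F\<in>set Qstar_shelling. set H \<subseteq> set F)"
    unfolding Qstar_shelling_def Astar_shelling_def by code_simp
  then obtain F where "set H \<subseteq> Astar_vertices" "F \<in> set Qstar_shelling" "set H \<subseteq> set F"
    using H(1) by blast
  then have "G \<subseteq> Astar_vertices" "G \<in> Qstar" using H(2) by (blast, auto simp: Qstar_eq)
  then show "G \<in> Astar" unfolding Astar_def by simp
qed

lemma constructible_Qstar: "constructible 4 Qstar"
proof -
  have "\<forall>F\<in>set Qstar_shelling. card (set F) = Suc 3"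
    unfolding Qstar_shelling_def by code_simp
  with shelling_Qstar show ?thesis
    using shelling_constructible[of Qstar_shelling 3] by (simp add: Qstar_eq Qstar_shelling_def)
qed

lemma constructible_Astar: "constructible 3 Astar"
proof -
  have "\<forall>F\<in>set Astar_shelling. card (set F) = Suc 2"
    unfolding Astar_shelling_def by code_simp
  with shelling_Astar show ?thesis
    using shelling_constructible[of Astar_shelling 2] by (simp add: Astar_eq Astar_shelling_def)
qed

lemma constructible_C3: "constructible 4 C3"
proof -
  have "constructible (Suc 3) (identify_copies (Suc 2) Qstar Astar)"
    using constructible_Qstar constructible_Astar Astar_induced
    by (intro constructible_identify_copies) simp_all
  then show ?thesis by (simp add: C3_def)
qed

text \<open>Shared and unshared faces are separated because only the latter are tripled in
  \<open>C3\<close>: 10 + 3*4 = 22, 17 + 3*28 = 101, 8 + 3*44 = 140, 0 + 3*20 = 60.\<close>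

lemma f_vector_Qstar:
  "map (\<lambda>j. card {G \<in> Qstar. G \<subseteq> \<Union>Astar \<and> card G = j}) [0, 1, 2, 3, 4] = [1, 10, 17, 8, 0]"
  "map (\<lambda>j. card {G \<in> Qstar. \<not> G \<subseteq> \<Union>Astar \<and> card G = j}) [0, 1, 2, 3, 4] = [0, 4, 28, 44, 20]"
proof -
  have sorted: "\<forall>F\<in>set Qstar_shelling. sorted_wrt (<) F"
    unfolding Qstar_shelling_def by code_simp
  show "map (\<lambda>j. card {G \<in> Qstar. G \<subseteq> \<Union>Astar \<and> card G = j}) [0, 1, 2, 3, 4] = [1, 10, 17, 8, 0]"
    unfolding Union_Astar Qstar_eq card_faces_eq_length[OF sorted]
    unfolding Qstar_shelling_def by code_simp
  show "map (\<lambda>j. card {G \<in> Qstar. \<not> G \<subseteq> \<Union>Astar \<and> card G = j}) [0, 1, 2, 3, 4] = [0, 4, 28, 44, 20]"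
    unfolding Union_Astar Qstar_eq card_faces_eq_length[OF sorted]
    unfolding Qstar_shelling_def by code_simp
qed

section \<open>Non-partitionability\<close>

text \<open>Suppose that neither edge is covered. The boundary triangles \<open>{2, 6, 9}\<close> and \<open>{4, 8, 9}\<close> then
  force \<open>1\<close> into the restriction sets of \<open>{1, 2, 5, 6}\<close> and \<open>{1, 4, 5, 8}\<close>. Hence the edge \<open>{2, 5}\<close> is
  covered by one of the other three facets containing it, and as each of these has a boundary triangle
  avoiding \<open>2\<close>, that facet covers \<open>{5}\<close> too. By the same argument \<open>{5}\<close> is covered by the facet that
  covers \<open>{4, 5}\<close>, a contradiction.\<close>
lemma Qstar_covers_edge:
  assumes part: "\<And>G. G \<in> Qstar \<Longrightarrow> \<not> G \<subseteq> \<Union>Astar \<Longrightarrow>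
      \<exists>!F. F \<in> Qstar_facets \<and> R F \<subseteq> G \<and> G \<subseteq> F"
  shows "\<exists>E\<in>{{2, 6}, {4, 8}}. \<exists>F\<in>Qstar_facets. R F \<subseteq> E \<and> E \<subseteq> F"
proof (rule ccontr)
  assume "\<not> ?thesis"
  then have n: "\<not> R F \<subseteq> E" if "F \<in> Qstar_facets" "E \<in> {{2, 6}, {4, 8}}" "E \<subseteq> F" for E F
    using that by blast
  have ex: "\<exists>F\<in>Qstar_facets. G \<subseteq> F \<and> R F \<subseteq> G"
    if "\<not> G \<subseteq> Astar_vertices" "\<exists>F\<in>Qstar_facets. G \<subseteq> F" for G
    using part[of G] that by (auto simp: Union_Astar Qstar_def)
  \<comment> \<open>Each of these triangles has a vertex outside \<open>Astar_vertices\<close> and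
    lies in a single facet, which must therefore cover it.\<close>
  have t: "R {1,2,6,9} \<subseteq> {2,6,9}" "R {1,4,8,9} \<subseteq> {4,8,9}" "R {0,1,2,5} \<subseteq> {0,1,5}"
      "R {0,2,5,12} \<subseteq> {0,5,12}" "R {2,5,6,12} \<subseteq> {5,6,12}" "R {1,4,5,7} \<subseteq> {1,5,7}"
      "R {4,5,7,13} \<subseteq> {5,7,13}" "R {4,5,8,13} \<subseteq> {5,8,13}"
    using ex[of "{2,6,9}"] ex[of "{4,8,9}"] ex[of "{0,1,5}"] ex[of "{0,5,12}"] ex[of "{5,6,12}"]
      ex[of "{1,5,7}"] ex[of "{5,7,13}"] ex[of "{5,8,13}"]
    by (simp_all add: Qstar_facets_def)
  have n1: "\<not> R {1,2,6,9} \<subseteq> {2,6}" "\<not> R {1,2,5,6} \<subseteq> {2,6}"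
      "\<not> R {1,4,8,9} \<subseteq> {4,8}" "\<not> R {1,4,5,8} \<subseteq> {4,8}"
    by (rule n; simp add: Qstar_facets_def)+
  \<comment> \<open>Both restriction sets contain \<open>9\<close>, so \<open>{1,2,6}\<close> and
    \<open>{1,4,8}\<close> are left to the only other facets containing them.\<close>
  have "\<not> R {1,2,6,9} \<subseteq> {1,2,6}" "\<not> R {1,4,8,9} \<subseteq> {1,4,8}"
    using t(1,2) n1(1,3) by (auto simp: subset_iff)
  then have "R {1,2,5,6} \<subseteq> {1,2,6}" "R {1,4,5,8} \<subseteq> {1,4,8}"
    using ex[of "{1,2,6}"] ex[of "{1,4,8}"] by (simp_all add: Qstar_facets_def)
  \<comment> \<open>The restriction sets lie in \<open>{1,2,6}\<close> and \<open>{1,4,8}\<close>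
    but not in \<open>{2,6}\<close> and \<open>{4,8}\<close>, so both contain
    \<open>1\<close>.\<close>
  then have n2: "\<not> R {1,2,5,6} \<subseteq> {2,5}" "\<not> R {1,4,5,8} \<subseteq> {4,5}"
    using n1(2,4) by (auto simp: subset_iff)
  have "R {0,1,2,5} \<subseteq> {2,5} \<or> R {0,2,5,12} \<subseteq> {2,5} \<or> R {2,5,6,12} \<subseteq> {2,5}"
    using ex[of "{2,5}"] n2(1) by (simp add: Qstar_facets_def) blast
  \<comment> \<open>The boundary triangles in \<open>t\<close> omit \<open>2\<close>, so
    \<open>2\<close> drops out of the restriction set.\<close>
  then have "R {0,1,2,5} \<subseteq> {5} \<or> R {0,2,5,12} \<subseteq> {5} \<or> R {2,5,6,12} \<subseteq> {5}"
    using t(3-5) by (auto simp: subset_iff)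
  then have "\<exists>F\<in>Qstar_facets. R F \<subseteq> {5} \<and> {5} \<subseteq> F \<and> 2 \<in> F"
    by (simp add: Qstar_facets_def) blast
  then obtain F where F: "F \<in> Qstar_facets" "R F \<subseteq> {5}" "{5} \<subseteq> F" "2 \<in> F"
    by blast
  have "R {1,4,5,7} \<subseteq> {4,5} \<or> R {4,5,7,13} \<subseteq> {4,5} \<or> R {4,5,8,13} \<subseteq> {4,5}"
    using ex[of "{4,5}"] n2(2) by (simp add: Qstar_facets_def) blast
  then have "R {1,4,5,7} \<subseteq> {5} \<or> R {4,5,7,13} \<subseteq> {5} \<or> R {4,5,8,13} \<subseteq> {5}"
    using t(6-8) by (auto simp: subset_iff)
  then have "\<exists>F\<in>Qstar_facets. R F \<subseteq> {5} \<and> {5} \<subseteq> F \<and> 4 \<in> F"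
    by (simp add: Qstar_facets_def) blast
  then obtain F' where F': "F' \<in> Qstar_facets" "R F' \<subseteq> {5}" "{5} \<subseteq> F'" "4 \<in> F'"
    by blast
  have "{5} \<in> Qstar" using F(1,3) by (auto simp: Qstar_def)
  \<comment> \<open>The vertex \<open>5\<close> is not shared, so \<open>{5}\<close> is covered only
    once; but no facet contains both \<open>2\<close> and \<open>4\<close>.\<close>
  then have "F = F'" using part[of "{5}"] F F' by (auto simp: Union_Astar)
  moreover have "\<forall>F\<in>set Qstar_shelling. \<not> (2 \<in> set F \<and> 4 \<in> set F)"
    unfolding Qstar_shelling_def by code_simp
  ultimately show False using F F' unfolding Qstar_facets_shelling by blast
qed

lemma Qstar_facetD:
  assumes "F \<in> Qstar_facets"
  shows "card F = 4" "F \<in> Qstar" "\<not> F \<subseteq> \<Union>Astar"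
proof -
  have "\<forall>F\<in>set Qstar_shelling. card (set F) = 4 \<and> \<not> set F \<subseteq> Astar_vertices"
    unfolding Qstar_shelling_def by code_simp
  then show "card F = 4" "\<not> F \<subseteq> \<Union>Astar"
    using assms unfolding Qstar_facets_shelling Union_Astar by blast+
  show "F \<in> Qstar" using assms by (auto simp: Qstar_def)
qed

text \<open>All these images have cardinality 4, the largest in \<open>C3\<close>, so none is
  properly contained in a face.\<close>

lemma facets_C3: "facets C3 = {copy_vertex Astar k ` F | k F. k < 3 \<and> F \<in> Qstar_facets}"
proof (intro equalityI subsetI)
  fix X assume X: "X \<in> facets C3"
  then obtain k G where kG: "X = copy_vertex Astar k ` G" "k < 3" "G \<in> Qstar"
    by (auto simp: facets_def C3_def identify_copies_def)
  then obtain F where F: "F \<in> Qstar_facets" "G \<subseteq> F" by (auto simp: Qstar_def)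
  then have "copy_vertex Astar k ` F \<in> C3" "X \<subseteq> copy_vertex Astar k ` F"
    using kG Qstar_facetD(2) by (auto simp: C3_def identify_copies_def)
  then have "X = copy_vertex Astar k ` F" using X by (auto simp: facets_def)
  then show "X \<in> {copy_vertex Astar k ` F | k F. k < 3 \<and> F \<in> Qstar_facets}" using kG F by blast
next
  fix X assume "X \<in> {copy_vertex Astar k ` F | k F. k < 3 \<and> F \<in> Qstar_facets}"
  then obtain k F where X: "X = copy_vertex Astar k ` F" "k < 3" "F \<in> Qstar_facets" by blast
  then have "card X = 4"
    using Qstar_facetD(1) by (simp add: card_image inj_on_subset[OF inj_copy_vertex])
  moreover have "finite Y" "card Y \<le> 4" if "Y \<in> C3" for Y
    using that constructible_card_le[OF constructible_C3] constructible_finite_Union[OF constructible_C3]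
    by (auto intro: finite_subset)
  ultimately have "Y = X" if "Y \<in> C3" "X \<subseteq> Y" for Y
    using that by (metis card_seteq)
  moreover have "X \<in> C3" using X Qstar_facetD(2) by (auto simp: C3_def identify_copies_def)
  ultimately show "X \<in> facets C3" by (simp add: facets_def)
qed

text \<open>The restriction map is pulled back along the injection of copy \<open>k\<close>, so that
  the statement about a single \<open>Qstar\<close> applies.\<close>

lemma copy_covers_edge:
  assumes R: "\<forall>X\<in>facets C3. R X \<subseteq> X" and "k < 3"
    and part: "\<forall>Y\<in>C3. \<exists>!X. X \<in> facets C3 \<and> R X \<subseteq> Y \<and> Y \<subseteq> X"
  shows "\<exists>E\<in>{{2, 6}, {4, 8}}. \<exists>F\<in>Qstar_facets.
    R (copy_vertex Astar k ` F) \<subseteq> Pair 0 ` E \<and> Pair 0 ` E \<subseteq> copy_vertex Astar k ` F"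
proof -
  let ?\<phi> = "copy_vertex Astar k"
  let ?R = "\<lambda>F. ?\<phi> -` R (?\<phi> ` F)"
  have facet: "?\<phi> ` F \<in> facets C3" if "F \<in> Qstar_facets" for F
    using that \<open>k < 3\<close> unfolding facets_C3 by blast
  have R_iff: "?R F \<subseteq> G \<longleftrightarrow> R (?\<phi> ` F) \<subseteq> ?\<phi> ` G" if "F \<in> Qstar_facets" for F G
  proof -
    \<comment> \<open>The restriction set lies in the image of the copy, so taking preimages loses
      nothing.\<close>
    have "R (?\<phi> ` F) \<subseteq> range ?\<phi>" using R facet[OF that] by blast
    then have "R (?\<phi> ` F) = ?\<phi> ` ?R F" by (simp add: Int_absorb2)
    then show ?thesis using inj_image_subset_iff[OF inj_copy_vertex, of Astar k "?R F" G] by simp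
  qed
  have "\<exists>!F. F \<in> Qstar_facets \<and> ?R F \<subseteq> G \<and> G \<subseteq> F" if G: "G \<in> Qstar" "\<not> G \<subseteq> \<Union>Astar" for G
  proof -
    have "?\<phi> ` G \<in> C3" using G \<open>k < 3\<close> by (auto simp: C3_def identify_copies_def)
    then have "\<exists>!X. X \<in> facets C3 \<and> R X \<subseteq> ?\<phi> ` G \<and> ?\<phi> ` G \<subseteq> X" by (rule part[rule_format])
    then obtain X where X: "X \<in> facets C3" "R X \<subseteq> ?\<phi> ` G" "?\<phi> ` G \<subseteq> X"
        and uniq: "\<forall>Y. Y \<in> facets C3 \<and> R Y \<subseteq> ?\<phi> ` G \<and> ?\<phi> ` G \<subseteq> Y \<longrightarrow> Y = X"
      by (elim ex1E conjE)
    then obtain l F where F: "X = copy_vertex Astar l ` F" "F \<in> Qstar_facets"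
      unfolding facets_C3 by blast
    \<comment> \<open>An unshared face forces its covering facet into the same copy.\<close>
    then have "l = k" "G \<subseteq> F" using X(3) copy_vertex_image_subset_iff[OF G(2), of k l F] by auto
    show ?thesis
    proof (rule ex1I[of _ F])
      show "F \<in> Qstar_facets \<and> ?R F \<subseteq> G \<and> G \<subseteq> F"
        using F X(2) R_iff[of F G] \<open>l = k\<close> \<open>G \<subseteq> F\<close> by simp
    next
      fix F' assume F': "F' \<in> Qstar_facets \<and> ?R F' \<subseteq> G \<and> G \<subseteq> F'"
      have "?\<phi> ` F' \<in> facets C3 \<and> R (?\<phi> ` F') \<subseteq> ?\<phi> ` G \<and> ?\<phi> ` G \<subseteq> ?\<phi> ` F'"
        using F' facet[of F'] R_iff[of F' G] image_mono[of G F' ?\<phi>] by simp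
      then have "?\<phi> ` F' = X" by (rule uniq[rule_format])
      then show "F' = F" using F(1) \<open>l = k\<close> by (simp add: inj_image_eq_iff[OF inj_copy_vertex])
    qed
  qed
  then obtain E F where EF: "E \<in> {{2, 6}, {4, 8}}" "F \<in> Qstar_facets" "?R F \<subseteq> E" "E \<subseteq> F"
    using Qstar_covers_edge[of ?R] by blast
  moreover have "?\<phi> ` E = Pair 0 ` E"
    using EF(1) by (intro copy_vertex_image_shared) (auto simp: Union_Astar)
  ultimately show ?thesis using R_iff[of F E] image_mono[of E F ?\<phi>] by (intro bexI) auto
qed

text \<open>Pigeonhole with three copies and two edges: two copies cover the same shared edge.
  Uniqueness identifies the two facets, yet a facet has an unshared vertex and so determines its
  copy.\<close>

lemma not_partitionable_C3: "\<not> partitionable C3"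
proof
  assume "partitionable C3"
  then obtain R where R: "\<forall>X\<in>facets C3. R X \<subseteq> X"
      and part: "\<forall>Y\<in>C3. \<exists>!X. X \<in> facets C3 \<and> R X \<subseteq> Y \<and> Y \<subseteq> X"
    unfolding partitionable_def by blast
  define cov where "cov k E \<longleftrightarrow> (\<exists>F\<in>Qstar_facets. R (copy_vertex Astar k ` F) \<subseteq> Pair 0 ` E
      \<and> Pair 0 ` E \<subseteq> copy_vertex Astar k ` F)" for k and E :: "nat set"
  have same: "k = l" if kl: "k < 3" "l < 3" "cov k E" "cov l E" for k l E
  proof -
    obtain F H where FH: "F \<in> Qstar_facets" "R (copy_vertex Astar k ` F) \<subseteq> Pair 0 ` E"
        "Pair 0 ` E \<subseteq> copy_vertex Astar k ` F"
        "H \<in> Qstar_facets" "R (copy_vertex Astar l ` H) \<subseteq> Pair 0 ` E"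
        "Pair 0 ` E \<subseteq> copy_vertex Astar l ` H"
      using kl unfolding cov_def by blast
    have fac: "copy_vertex Astar k ` F \<in> facets C3" "copy_vertex Astar l ` H \<in> facets C3"
      using FH kl unfolding facets_C3 by blast+
    then have "Pair 0 ` E \<in> C3"
      using FH(3) constructible_down[OF constructible_C3] by (auto simp: facets_def)
    then have "copy_vertex Astar k ` F = copy_vertex Astar l ` H" using part fac FH by blast
    then show "k = l"
      using copy_vertex_image_subset_iff[OF Qstar_facetD(3)[OF FH(1)], of k l H] by simp
  qed
  have "cov k {2, 6} \<or> cov k {4, 8}" if "k < 3" for k
    using copy_covers_edge[OF R that part] unfolding cov_def by auto
  from this[of 0] this[of 1] this[of 2] show False
    using same[of 0 1] same[of 0 2] same[of 1 2] by auto
qed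

section \<open>Balancedness\<close>

lemma balanced_C3: "balanced C3"
proof -
  \<comment> \<open>A 4-colouring of the vertices of \<open>Qstar\<close> using every colour once on
    each facet. Composing it with \<open>snd\<close> gives the same colours in every copy.\<close>
  define col :: "nat \<Rightarrow> nat" where
    "col v = (if v \<in> {1, 12, 13} then 1 else if v \<in> {2, 4, 11} then 2
      else if v \<in> {3, 5, 9} then 3 else 0)" for v
  have "\<forall>F\<in>set Qstar_shelling. \<forall>u\<in>set F. \<forall>v\<in>set F. u = v \<or> col u \<noteq> col v"
    unfolding Qstar_shelling_def col_def by code_simp
  then have col: "col u \<noteq> col v" if "F \<in> Qstar_facets" "u \<in> F" "v \<in> F" "u \<noteq> v" for F u v
    using that unfolding Qstar_facets_shelling by blast
  have snd_copy: "snd (copy_vertex A k v) = v" for A k and v :: nat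
    by (simp add: copy_vertex_def)
  have "col (snd x) \<noteq> col (snd y)" if xy: "{x, y} \<in> C3" "x \<noteq> y" for x y
  proof -
    obtain k G where G: "{x, y} = copy_vertex Astar k ` G" "G \<in> Qstar"
      using xy by (auto simp: C3_def identify_copies_def)
    then obtain F where F: "F \<in> Qstar_facets" "G \<subseteq> F" by (auto simp: Qstar_def)
    have "x \<in> copy_vertex Astar k ` G" "y \<in> copy_vertex Astar k ` G" using G(1) by auto
    then obtain u v where "x = copy_vertex Astar k u" "y = copy_vertex Astar k v" "u \<in> G" "v \<in> G"
      by blast
    then show ?thesis using col[of F u v] F xy(2) snd_copy by auto
  qed
  moreover have "col v < cx_d C3" for v
    by (simp add: col_def constructible_cx_d[OF constructible_C3])
  ultimately show ?thesis
    unfolding balanced_def by (intro exI[of _ "\<lambda>x. col (snd x)"]) blast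
qed

theorem theorem3p8:
  shows "balanced C3 \<and> (\<forall>K :: 'k::field itself. cohen_macaulay K C3) \<and> \<not> partitionable C3 \<and>
    map (\<lambda>j. card {G \<in> C3. card G = j}) [0, 1, 2, 3, 4] = [1, 22, 101, 140, 60]"
proof (intro conjI allI)
  have "finite Qstar"
    using constructible_finite_Union[OF constructible_Qstar] by (rule finite_UnionD)
  then have "card {G \<in> C3. card G = j} = card {G \<in> Qstar. G \<subseteq> \<Union>Astar \<and> card G = j}
      + 3 * card {G \<in> Qstar. \<not> G \<subseteq> \<Union>Astar \<and> card G = j}" for j
    unfolding C3_def using Astar_induced by (intro card_identify_copies) simp_all
  then show "map (\<lambda>j. card {G \<in> C3. card G = j}) [0, 1, 2, 3, 4] = [1, 22, 101, 140, 60]"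
    using f_vector_Qstar by simp
qed (rule balanced_C3 not_partitionable_C3 constructible_cohen_macaulay[OF constructible_C3])+

end
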